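(* Let $a,b,c,k,l,m$ be positive integers with $c\mid ab$ and $k,l\ge m$, let $i\in\{1,2\}$, and let $d=d_i^{\pm}=a^{2k}b^{2l}\pm i c^m$ (for a fixed choice of sign) be a square-free positive integer. Let $F_{\Delta_d}(x,y)=x^2-dy^2$, let $(x_1,y_1)$ be the fundamental solution of $x^2-dy^2=1$, and put $$g=g_{F_{\Delta_d}}=\begin{pmatrix} x_1 & y_1 \\ y_1d & x_1 \end{pmatrix}.$$ Then: (i) the set of proper automorphisms of $F_{\Delta_d}$ is $Aut^+(F_{\Delta_d})=\{\pm g^n:\ n\in\mathbb Z\}$; (ii) the integer solutions of $F_{\Delta_d}(x,y)=1$ are $(x_n,y_n)$, where $\begin{pmatrix} x_n \\ y_n \end{pmatrix}=(g^n)^{T}\begin{pmatrix} 1 \\ 0 \end{pmatrix}$ for $n\ge1$.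
   Context: The fundamental solution is the solution in positive integers with least positive values; in (ii) "integer solutions" means the solutions in positive integers. For a form $F(x,y)=Ax^2+Bxy+Cy^2$ and an integer matrix $g=\begin{pmatrix} r & s \\ t & u \end{pmatrix}$ of determinant $\pm1$, the form $gF$ is defined by $gF(x,y)=(Ar^2+Brs+Cs^2)x^2+(2Art+Bru+Bts+2Csu)xy+(At^2+Btu+Cu^2)y^2$. A proper automorphism of $F$ is such a $g$ with $gF=F$ and $\det g=1$; $Aut^+(F)$ is the set of proper automorphisms. $T$ denotes transpose. *)

theory Defs
  imports "HOL-Analysis.Analysis" "HOL-Computational_Algebra.Squarefree"
begin

datatype bqf = BQF (qA: int) (qB: int) (qC: int)

definition bqf_eval :: "bqf \<Rightarrow> int \<Rightarrow> int \<Rightarrow> int" where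
  "bqf_eval F x y = qA F * x\<^sup>2 + qB F * x * y + qC F * y\<^sup>2"

definition mat22 :: "int \<Rightarrow> int \<Rightarrow> int \<Rightarrow> int \<Rightarrow> int^2^2" where
  "mat22 r s t u = vector [vector [r, s], vector [t, u]]"

(* g acts on the variables by its transpose: gF(x,y) = F(rx + ty, sx + uy). *)
definition bqf_act :: "int^2^2 \<Rightarrow> bqf \<Rightarrow> bqf" where
  "bqf_act g F =
    (let A = qA F; B = qB F; C = qC F;
         r = g $ 1 $ 1; s = g $ 1 $ 2; t = g $ 2 $ 1; u = g $ 2 $ 2
     in BQF (A * r\<^sup>2 + B * r * s + C * s\<^sup>2)
            (2 * A * r * t + B * r * u + B * t * s + 2 * C * s * u)
            (A * t\<^sup>2 + B * t * u + C * u\<^sup>2))"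

definition proper_automorphisms :: "bqf \<Rightarrow> (int^2^2) set" where
  "proper_automorphisms F = {g. bqf_act g F = F \<and> det g = 1}"

primrec mat_pow :: "int^2^2 \<Rightarrow> nat \<Rightarrow> int^2^2" where
  "mat_pow M 0 = mat 1"
| "mat_pow M (Suc n) = M ** mat_pow M n"

(* Negative powers are meaningful only if M is invertible over the integers. *)
definition mat_powi :: "int^2^2 \<Rightarrow> int \<Rightarrow> int^2^2" where
  "mat_powi M n = (if n \<ge> 0 then mat_pow M (nat n) else mat_pow (matrix_inv M) (nat (- n)))"

definition pell_form :: "int \<Rightarrow> bqf" where
  "pell_form d = BQF 1 0 (- d)"

definition pell_fundamental :: "int \<Rightarrow> int \<Rightarrow> int \<Rightarrow> bool" where
  "pell_fundamental d x1 y1 \<longleftrightarrow>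
     x1 > 0 \<and> y1 > 0 \<and> x1\<^sup>2 - d * y1\<^sup>2 = 1 \<and>
     (\<forall>x y. x > 0 \<and> y > 0 \<and> x\<^sup>2 - d * y\<^sup>2 = 1 \<longrightarrow> x1 \<le> x \<and> y1 \<le> y)"

end

theory Submission
  imports Defs
begin

text \<open>
  The equations for a proper automorphism of \<open>x\<^sup>2 - d y\<^sup>2\<close> force its matrix to have rows
  \<open>(x, y)\<close> and \<open>(y d, x)\<close> with \<open>x\<^sup>2 - d y\<^sup>2 = 1\<close>; such matrices multiply like the numbers
  \<open>x + y \<surd>d\<close>. A solution with \<open>x, y > 0\<close> is at least the fundamental one, so multiplying it by the
  inverse of the fundamental solution keeps it in the quadrant \<open>x > 0, y \<ge> 0\<close> and decreases
  \<open>y\<close>. Descent ends at \<open>(1, 0)\<close>; hence every solution in that quadrant is a power of the fundamental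
  one, and the other quadrants are reached by inversion and negation.
\<close>

section \<open>Matrix model of the numbers x + y \<surd>d\<close>

text \<open>The rows are the coordinates of (x + y \<surd>d) * 1 and (x + y \<surd>d) * \<surd>d in
  the basis 1, \<surd>d.\<close>

definition pell_mat :: "int \<Rightarrow> int \<Rightarrow> int \<Rightarrow> int^2^2" where
  "pell_mat d x y = mat22 x y (y * d) x"

lemma mat22_nth [simp]:
  "mat22 r s t u $ 1 $ 1 = r" "mat22 r s t u $ 1 $ 2 = s"
  "mat22 r s t u $ 2 $ 1 = t" "mat22 r s t u $ 2 $ 2 = u"
  by (simp_all add: mat22_def)

lemma mat22_eta: "mat22 (M $ 1 $ 1) (M $ 1 $ 2) (M $ 2 $ 1) (M $ 2 $ 2) = M"
  by (simp add: vec_eq_iff forall_2)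

lemma pell_mat_mult:
  "pell_mat d x y ** pell_mat d x' y' = pell_mat d (x * x' + d * y * y') (x * y' + y * x')"
  by (simp add: pell_mat_def vec_eq_iff forall_2 matrix_matrix_mult_def sum_2 algebra_simps)

lemma pell_mat_1_0: "pell_mat d 1 0 = mat 1"
  by (simp add: pell_mat_def vec_eq_iff forall_2 mat_def)

lemma uminus_pell_mat: "- pell_mat d x y = pell_mat d (- x) (- y)"
  by (simp add: pell_mat_def vec_eq_iff forall_2)

lemma pell_mat_inject: "pell_mat d x y = pell_mat d x' y' \<longleftrightarrow> x = x' \<and> y = y'"
  by (auto simp: pell_mat_def vec_eq_iff forall_2)

lemma pell_mat_inverse:
  assumes "x\<^sup>2 - d * y\<^sup>2 = 1"
  shows "pell_mat d x y ** pell_mat d x (- y) = mat 1" "pell_mat d x (- y) ** pell_mat d x y = mat 1"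
  using assms by (simp_all add: pell_mat_mult power2_eq_square algebra_simps flip: pell_mat_1_0[of d])

text \<open>Conjugation inverts an element of norm 1. Since \<open>matrix_inv\<close> is a choice
  among two-sided inverses, uniqueness of the inverse identifies it.\<close>

lemma matrix_inv_pell_mat:
  assumes "x\<^sup>2 - d * y\<^sup>2 = 1"
  shows "matrix_inv (pell_mat d x y) = pell_mat d x (- y)"
proof -
  let ?P = "pell_mat d x y"
  have "?P ** matrix_inv ?P = mat 1 \<and> matrix_inv ?P ** ?P = mat 1"
    unfolding matrix_inv_def by (rule someI) (use pell_mat_inverse[OF assms] in blast)
  then show ?thesis
    by (metis pell_mat_inverse(1)[OF assms] matrix_mul_assoc matrix_mul_lid matrix_mul_rid)
qed

text \<open>The first row is read off, so the formula in (ii) returns the solution encoded by the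
  matrix.\<close>

lemma transpose_pell_mat_mult: "transpose (pell_mat d x y) *v vector [1, 0] = vector [x, y]"
  by (simp add: pell_mat_def vec_eq_iff forall_2 matrix_vector_mult_def transpose_def sum_2)

lemma vector_2_inject: "(vector [x, y] :: 'a::zero^2) = vector [x', y'] \<longleftrightarrow> x = x' \<and> y = y'"
  by (auto simp: vec_eq_iff forall_2)

section \<open>Shape of the proper automorphisms\<close>

lemma pell_solution_nonzero:
  fixes x y d :: int
  assumes "x\<^sup>2 - d * y\<^sup>2 = 1" "d > 0"
  shows "x \<noteq> 0"
proof
  assume "x = 0"
  with assms(1) have "d * y\<^sup>2 = -1"
    by simp
  moreover have "d * y\<^sup>2 \<ge> 0"
    using assms(2) by simp
  ultimately show False
    by simp
qed

lemma pell_mat_in_proper_automorphisms: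
  assumes "x\<^sup>2 - d * y\<^sup>2 = 1"
  shows "pell_mat d x y \<in> proper_automorphisms (pell_form d)"
proof -
  have "(y * d)\<^sup>2 - d * x\<^sup>2 = - d * (x\<^sup>2 - d * y\<^sup>2)"
    by algebra
  then have norm': "(y * d)\<^sup>2 - d * x\<^sup>2 = - d"
    by (simp add: assms)
  have det: "x * x - y * (y * d) = 1"
    using assms by (simp add: power2_eq_square mult_ac)
  show ?thesis
    by (simp add: proper_automorphisms_def bqf_act_def pell_form_def pell_mat_def det_2
        assms norm' det)
qed

lemma proper_automorphism_pell_matE:
  assumes "M \<in> proper_automorphisms (pell_form d)" "d > 0"
  obtains x y where "M = pell_mat d x y" "x\<^sup>2 - d * y\<^sup>2 = 1"
proof -
  define r s t u where "r = M $ 1 $ 1" and "s = M $ 1 $ 2" and "t = M $ 2 $ 1" and "u = M $ 2 $ 2"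
  have M: "M = mat22 r s t u"
    by (simp add: r_def s_def t_def u_def mat22_eta)
  have norm: "r\<^sup>2 - d * s\<^sup>2 = 1" and cross: "r * t = d * s * u"
    and norm': "t\<^sup>2 - d * u\<^sup>2 = - d" and det: "r * u - s * t = 1"
    using assms(1) by (auto simp: M proper_automorphisms_def bqf_act_def pell_form_def det_2)
  \<comment> \<open>Multiplying \<open>t\<close> by the determinant and eliminating
    \<open>r * t\<close> by \<open>cross\<close> leaves the factor \<open>t^2 - d * u^2\<close>,
    which is \<open>- d\<close>.\<close>
  have "t = t * (r * u - s * t)"
    by (simp add: det)
  also have "\<dots> = u * (r * t) - s * t\<^sup>2"
    by (simp add: power2_eq_square algebra_simps)
  also have "\<dots> = - s * (t\<^sup>2 - d * u\<^sup>2)"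
    by (simp add: cross power2_eq_square algebra_simps)
  finally have t: "t = s * d"
    by (simp add: norm')
  \<comment> \<open>With \<open>t = s * d\<close>, determinant and norm are both 1 and share the
    term \<open>d * s^2\<close>; afterwards \<open>r\<close> cancels.\<close>
  have "r * u = r * r"
    using det norm by (simp add: t power2_eq_square algebra_simps)
  moreover have "r \<noteq> 0"
    using norm assms(2) by (rule pell_solution_nonzero)
  ultimately have "u = r"
    by simp
  then show thesis
    using that[of r s] M t norm by (simp add: pell_mat_def)
qed

section \<open>Powers of a solution matrix\<close>

text \<open>Conjugation \<surd>d to -\<surd>d is multiplicative, so it commutes with powers. This
  turns powers of the inverse into conjugates of powers.\<close>

lemma mat_pow_pell_mat_conjugate:
  "mat_pow (pell_mat d x y) n = pell_mat d x' y' \<Longrightarrow>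
   mat_pow (pell_mat d x (- y)) n = pell_mat d x' (- y')"
proof (induction n arbitrary: x' y')
  case 0
  then show ?case
    by (simp add: pell_mat_inject flip: pell_mat_1_0[of d])
next
  case (Suc n)
  have "\<exists>p q. mat_pow (pell_mat d x y) n = pell_mat d p q" for n
    by (induction n) (force simp: pell_mat_mult simp flip: pell_mat_1_0[of d])+
  then obtain p q where pq: "mat_pow (pell_mat d x y) n = pell_mat d p q"
    by blast
  with Suc show ?case
    by (auto simp: pell_mat_mult pell_mat_inject algebra_simps)
qed

text \<open>The norm is multiplicative and products of positive solutions are positive; exponent 0
  gives (1, 0), hence only \<open>q \<ge> 0\<close> in general.\<close>

lemma mat_pow_pell_matE:
  assumes "x > 0" "y > 0" "x\<^sup>2 - d * y\<^sup>2 = 1" "d > 0"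
  obtains p q where "mat_pow (pell_mat d x y) n = pell_mat d p q" "p\<^sup>2 - d * q\<^sup>2 = 1"
    "p > 0" "q \<ge> 0" "n > 0 \<Longrightarrow> q > 0"
proof -
  have "\<exists>p q. mat_pow (pell_mat d x y) n = pell_mat d p q \<and> p\<^sup>2 - d * q\<^sup>2 = 1 \<and>
    p > 0 \<and> q \<ge> 0 \<and> (n > 0 \<longrightarrow> q > 0)"
  proof (induction n)
    case 0
    show ?case
      by (intro exI[of _ 1] exI[of _ 0]) (simp add: pell_mat_1_0)
  next
    case (Suc n)
    then obtain p q where pq: "mat_pow (pell_mat d x y) n = pell_mat d p q"
      "p\<^sup>2 - d * q\<^sup>2 = 1" "p > 0" "q \<ge> 0"
      by blast
    have "(x * p + d * y * q)\<^sup>2 - d * (x * q + y * p)\<^sup>2 = (x\<^sup>2 - d * y\<^sup>2) * (p\<^sup>2 - d * q\<^sup>2)"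
      by algebra
    moreover have "x * p + d * y * q > 0" "x * q + y * p > 0"
      using assms pq by (simp_all add: add_pos_nonneg add_nonneg_pos)
    ultimately show ?case
      using pq(1,2) assms(3)
      by (intro exI[of _ "x * p + d * y * q"] exI[of _ "x * q + y * p"]) (simp add: pell_mat_mult)
  qed
  with that show thesis
    by blast
qed

section \<open>Descent to the fundamental solution\<close>

lemma pell_descent:
  assumes "pell_fundamental d x1 y1" "d > 0" "x > 0" "y \<ge> 0" "x\<^sup>2 - d * y\<^sup>2 = 1"
  shows "\<exists>n. pell_mat d x y = mat_pow (pell_mat d x1 y1) n"
  using assms(3-5)
proof (induction "nat y" arbitrary: x y rule: less_induct)
  case less
  have fund: "x1 > 0" "y1 > 0" "x1\<^sup>2 - d * y1\<^sup>2 = 1"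
    using assms(1) by (auto simp: pell_fundamental_def)
  show ?case
  proof (cases "y = 0")
    case True
    with less.prems have "x = 1"
      by (simp add: power2_eq_1_iff)
    with True show ?thesis
      by (intro exI[of _ 0]) (simp add: pell_mat_1_0)
  next
    case False
    with less.prems have "y > 0"
      by simp
    then have "y1 \<le> y"
      using assms(1) less.prems by (auto simp: pell_fundamental_def)
    \<comment> \<open>These are the coordinates of (x + y \<surd>d) * (x1 - y1 \<surd>d), the
      quotient by the fundamental solution.\<close>
    define x' y' where "x' = x * x1 - d * y * y1" and "y' = y * x1 - x * y1"
    have x_sq: "x\<^sup>2 = 1 + d * y\<^sup>2" and x1_sq: "x1\<^sup>2 = 1 + d * y1\<^sup>2"
      using less.prems fund by simp_all
    have "(x * x1)\<^sup>2 = (1 + d * y\<^sup>2) * (1 + d * y1\<^sup>2)"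
      by (simp only: power_mult_distrib x_sq x1_sq)
    also have "\<dots> = (d * y * y1)\<^sup>2 + (1 + d * y\<^sup>2 + d * y1\<^sup>2)"
      by algebra
    finally have "(d * y * y1)\<^sup>2 < (x * x1)\<^sup>2"
      using assms(2) by (simp add: add_pos_nonneg)
    then have "x' > 0"
      using power2_less_imp_less[of "d * y * y1" "x * x1"] less.prems fund by (simp add: x'_def)
    \<comment> \<open>Minimality of \<open>y1\<close> enters here: the difference of squares is
      \<open>y^2 - y1^2\<close>, which yields \<open>y' \<ge> 0\<close>.\<close>
    have "(y * x1)\<^sup>2 - (x * y1)\<^sup>2 = y\<^sup>2 * (1 + d * y1\<^sup>2) - (1 + d * y\<^sup>2) * y1\<^sup>2"
      by (simp only: power_mult_distrib x_sq x1_sq)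
    also have "\<dots> = y\<^sup>2 - y1\<^sup>2"
      by algebra
    finally have "(x * y1)\<^sup>2 \<le> (y * x1)\<^sup>2"
      using power_mono[OF \<open>y1 \<le> y\<close>, of 2] fund by simp
    then have "y' \<ge> 0"
      using power2_le_imp_le[of "x * y1" "y * x1"] \<open>y > 0\<close> fund by (simp add: y'_def)
    have "x1 \<noteq> 1"
      using x1_sq fund assms(2) by auto
    then have "x1 > 1"
      using fund by simp
    \<comment> \<open>The claim \<open>y' < y\<close> means \<open>y * (x1 - 1) < x * y1\<close>;
      the squares differ by a positive amount because \<open>x1 > 1\<close> and
      \<open>y1 > 0\<close>.\<close>
    have "(x * y1)\<^sup>2 = y1\<^sup>2 + y\<^sup>2 * (d * y1\<^sup>2)"
      by (simp only: power_mult_distrib x_sq) algebra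
    also have "\<dots> = y1\<^sup>2 + y\<^sup>2 * (x1\<^sup>2 - 1)"
      by (simp add: x1_sq)
    also have "\<dots> = (y * (x1 - 1))\<^sup>2 + (y1\<^sup>2 + 2 * y\<^sup>2 * (x1 - 1))"
      by algebra
    finally have "(y * (x1 - 1))\<^sup>2 < (x * y1)\<^sup>2"
      using \<open>x1 > 1\<close> fund by (simp add: add_pos_nonneg)
    then have "y' < y"
      using power2_less_imp_less[of "y * (x1 - 1)" "x * y1"] less.prems fund
      by (simp add: y'_def algebra_simps)
    have "x'\<^sup>2 - d * y'\<^sup>2 = (x\<^sup>2 - d * y\<^sup>2) * (x1\<^sup>2 - d * y1\<^sup>2)"
      unfolding x'_def y'_def by algebra
    then have "x'\<^sup>2 - d * y'\<^sup>2 = 1"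
      using less.prems fund by simp
    then obtain n where n: "pell_mat d x' y' = mat_pow (pell_mat d x1 y1) n"
      using less.hyps[of y' x'] \<open>x' > 0\<close> \<open>y' \<ge> 0\<close> \<open>y' < y\<close> by auto
    \<comment> \<open>Multiplying back by the fundamental solution restores \<open>(x, y)\<close> up
      to its norm, which is 1.\<close>
    have "pell_mat d x1 y1 ** pell_mat d x' y' =
        pell_mat d (x * (x1\<^sup>2 - d * y1\<^sup>2)) (y * (x1\<^sup>2 - d * y1\<^sup>2))"
      by (simp add: pell_mat_mult pell_mat_inject x'_def y'_def power2_eq_square algebra_simps)
    then have "pell_mat d x y = mat_pow (pell_mat d x1 y1) (Suc n)"
      using n fund by simp
    then show ?thesis
      by blast
  qed
qed

section \<open>Integer powers of the fundamental matrix and the two claims\<close>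

context
  fixes d x1 y1 :: int
  assumes fundamental: "pell_fundamental d x1 y1" and d_pos: "d > 0"
begin

lemma fundamental_solution: "x1 > 0" "y1 > 0" "x1\<^sup>2 - d * y1\<^sup>2 = 1"
  using fundamental by (auto simp: pell_fundamental_def)

lemma mat_powi_pell_mat_neg:
  assumes "mat_pow (pell_mat d x1 y1) n = pell_mat d p q"
  shows "mat_powi (pell_mat d x1 y1) (- int n) = pell_mat d p (- q)"
  using mat_pow_pell_mat_conjugate[OF assms] assms
  \<comment> \<open>Exponent 0 falls into the nonnegative branch of \<open>mat_powi\<close>; there
    both powers are the identity.\<close>
  by (cases "n = 0")
    (simp_all add: mat_powi_def matrix_inv_pell_mat fundamental_solution)

lemma mat_powi_pell_matE:
  obtains p q where "mat_powi (pell_mat d x1 y1) n = pell_mat d p q" "p\<^sup>2 - d * q\<^sup>2 = 1"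
    "p > 0" "n > 0 \<Longrightarrow> q > 0"
proof (cases "n \<ge> 0")
  case True
  obtain p q where "mat_pow (pell_mat d x1 y1) (nat n) = pell_mat d p q" "p\<^sup>2 - d * q\<^sup>2 = 1"
    "p > 0" "nat n > 0 \<Longrightarrow> q > 0"
    using mat_pow_pell_matE[OF fundamental_solution d_pos] by metis
  with True that[of p q] show thesis
    by (simp add: mat_powi_def)
next
  case False
  obtain p q where pq: "mat_pow (pell_mat d x1 y1) (nat (- n)) = pell_mat d p q"
    "p\<^sup>2 - d * q\<^sup>2 = 1" "p > 0"
    using mat_pow_pell_matE[OF fundamental_solution d_pos] by metis
  with False that[of p "- q"] mat_powi_pell_mat_neg[OF pq(1)] show thesis
    by simp
qed

lemma pell_mat_eq_mat_powi:
  assumes "x > 0" "x\<^sup>2 - d * y\<^sup>2 = 1"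
  shows "\<exists>n. pell_mat d x y = mat_powi (pell_mat d x1 y1) n"
proof -
  \<comment> \<open>Descent covers only nonnegative second coordinates, so it is applied to
    \<open>\<bar>y\<bar>\<close>; the sign of \<open>y\<close> then becomes the sign of the
    exponent.\<close>
  obtain n where n: "pell_mat d x \<bar>y\<bar> = mat_pow (pell_mat d x1 y1) n"
    using pell_descent[OF fundamental d_pos, of x "\<bar>y\<bar>"] assms by auto
  show ?thesis
  proof (cases "y \<ge> 0")
    case True
    with n show ?thesis
      by (intro exI[of _ "int n"]) (simp add: mat_powi_def)
  next
    case False
    with mat_powi_pell_mat_neg[OF n[symmetric]] show ?thesis
      by (intro exI[of _ "- int n"]) simp
  qed
qed

lemma proper_automorphisms_pell_form:
  "proper_automorphisms (pell_form d) =
     {M. \<exists>n. M = mat_powi (pell_mat d x1 y1) n \<or> M = - mat_powi (pell_mat d x1 y1) n}"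
proof (intro equalityI subsetI CollectI)
  fix M assume "M \<in> proper_automorphisms (pell_form d)"
  then obtain x y where M: "M = pell_mat d x y" and norm: "x\<^sup>2 - d * y\<^sup>2 = 1"
    using d_pos by (rule proper_automorphism_pell_matE)
  have "x \<noteq> 0"
    using norm d_pos by (rule pell_solution_nonzero)
  \<comment> \<open>The sign of \<open>x\<close> decides between \<open>M\<close> and
    \<open>- M\<close>.\<close>
  then consider "x > 0" | "- x > 0"
    by linarith
  then show "\<exists>n. M = mat_powi (pell_mat d x1 y1) n \<or> M = - mat_powi (pell_mat d x1 y1) n"
  proof cases
    case 1
    with pell_mat_eq_mat_powi norm M show ?thesis
      by blast
  next
    case 2
    with pell_mat_eq_mat_powi[of "- x" "- y"] norm
    obtain n where "- M = mat_powi (pell_mat d x1 y1) n"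
      by (auto simp: M uminus_pell_mat)
    then show ?thesis
      by (metis minus_minus)
  qed
next
  fix M assume "M \<in> {M. \<exists>n. M = mat_powi (pell_mat d x1 y1) n \<or> M = - mat_powi (pell_mat d x1 y1) n}"
  then obtain n where n: "M = mat_powi (pell_mat d x1 y1) n \<or> M = - mat_powi (pell_mat d x1 y1) n"
    by blast
  obtain p q where "mat_powi (pell_mat d x1 y1) n = pell_mat d p q" "p\<^sup>2 - d * q\<^sup>2 = 1"
    by (rule mat_powi_pell_matE)
  with n show "M \<in> proper_automorphisms (pell_form d)"
    by (auto simp: uminus_pell_mat intro!: pell_mat_in_proper_automorphisms)
qed

lemma pell_form_positive_solutions:
  "{(x, y). x > 0 \<and> y > 0 \<and> bqf_eval (pell_form d) x y = 1} =
     {(x, y). \<exists>n\<ge>1. vector [x, y] =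
        transpose (mat_powi (pell_mat d x1 y1) n) *v (vector [1, 0] :: int^2)}"
proof -
  have "(x > 0 \<and> y > 0 \<and> x\<^sup>2 - d * y\<^sup>2 = 1) \<longleftrightarrow>
      (\<exists>n\<ge>1. vector [x, y] =
        transpose (mat_powi (pell_mat d x1 y1) n) *v (vector [1, 0] :: int^2))" for x y
  proof
    assume xy: "x > 0 \<and> y > 0 \<and> x\<^sup>2 - d * y\<^sup>2 = 1"
    then obtain n where n: "pell_mat d x y = mat_pow (pell_mat d x1 y1) n"
      using pell_descent[OF fundamental d_pos, of x y] by auto
    \<comment> \<open>Exponent 0 would give (1, 0), against \<open>y > 0\<close>; this is why (ii)
      starts at n = 1.\<close>
    have "n \<noteq> 0"
    proof
      assume "n = 0"
      with n have "pell_mat d x y = pell_mat d 1 0"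
        by (simp add: pell_mat_1_0)
      with xy show False
        by (simp add: pell_mat_inject)
    qed
    then show "\<exists>n\<ge>1. vector [x, y] =
        transpose (mat_powi (pell_mat d x1 y1) n) *v (vector [1, 0] :: int^2)"
      by (intro exI[of _ "int n"])
        (simp add: mat_powi_def transpose_pell_mat_mult del: transpose_matrix_vector flip: n)
  next
    assume "\<exists>n\<ge>1. vector [x, y] =
        transpose (mat_powi (pell_mat d x1 y1) n) *v (vector [1, 0] :: int^2)"
    then obtain n where n: "n \<ge> 1" "vector [x, y] =
        transpose (mat_powi (pell_mat d x1 y1) n) *v (vector [1, 0] :: int^2)"
      by blast
    obtain p q where pq: "mat_powi (pell_mat d x1 y1) n = pell_mat d p q" "p\<^sup>2 - d * q\<^sup>2 = 1"
      "p > 0" "n > 0 \<Longrightarrow> q > 0"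
      by (rule mat_powi_pell_matE) (rule that)
    with n show "x > 0 \<and> y > 0 \<and> x\<^sup>2 - d * y\<^sup>2 = 1"
      by (simp add: transpose_pell_mat_mult vector_2_inject del: transpose_matrix_vector)
  qed
  then show ?thesis
    by (simp add: bqf_eval_def pell_form_def)
qed

end

theorem theorem5p6:
  fixes a b c i \<sigma> d x1 y1 :: int and k l m :: nat and g :: "int^2^2"
  assumes "a > 0" "b > 0" "c > 0" "k > 0" "l > 0" "m > 0"
    and "c dvd a * b" "k \<ge> m" "l \<ge> m"
    and "i \<in> {1, 2}" "\<sigma> \<in> {1, -1}"
    and "d = a ^ (2 * k) * b ^ (2 * l) + \<sigma> * i * c ^ m"
    and "d > 0" "squarefree d"
    and "pell_fundamental d x1 y1"
    and "g = mat22 x1 y1 (y1 * d) x1"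
  shows "proper_automorphisms (pell_form d)
           = {M. \<exists>n::int. M = mat_powi g n \<or> M = - mat_powi g n}
       \<and> {(x, y). x > 0 \<and> y > 0 \<and> bqf_eval (pell_form d) x y = 1}
           = {(x, y). \<exists>n::int. n \<ge> 1 \<and>
                vector [x, y] = transpose (mat_powi g n) *v (vector [1, 0] :: int^2)}"
proof -
  have "g = pell_mat d x1 y1"
    by (simp only: assms(16) pell_mat_def)
  then show ?thesis
    using proper_automorphisms_pell_form[OF assms(15,13)]
      pell_form_positive_solutions[OF assms(15,13)] by (simp only:)
qed

end
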